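(* Let $r\in\mathbb{R}\setminus\{0\}$ and let $\chi>0$ be defined by $\rho/p=\chi^r$. For the two-dimensional Euler equations, define two-point numerical fluxes (for all pairs of states with $\rho,p>0$) by $$f^{x}_{\rho}=\{\{\rho\}\}_{\log}\{\{v_x\}\},\quad f^x_{\rho v_x}=\{\{v_x\}\}f^x_\rho+\frac{\{\{\rho\}\}}{\{\{\rho/p\}\}},\quad f^x_{\rho v_y}=\{\{v_y\}\}f^x_\rho,$$ $$f^x_{\rho e}=\left(\frac{1}{\gamma-1}\frac{1}{\{\{\chi\}\}_{x\mapsto x^r}^{r-1}\{\{\chi\}\}_{\log}}-\frac{\{\{v_x^2\}\}+\{\{v_y^2\}\}}{2}\right)f^x_\rho+\{\{v_x\}\}f^x_{\rho v_x}+\{\{v_y\}\}f^x_{\rho v_y},$$ and $$f^{y}_{\rho}=\{\{\rho\}\}_{\log}\{\{v_y\}\},\quad f^y_{\rho v_x}=\{\{v_x\}\}f^y_\rho,\quad f^y_{\rho v_y}=\{\{v_y\}\}f^y_\rho+\frac{\{\{\rho\}\}}{\{\{\rho/p\}\}},$$ $$f^y_{\rho e}=\left(\frac{1}{\gamma-1}\frac{1}{\{\{\chi\}\}_{x\mapsto x^r}^{r-1}\{\{\chi\}\}_{\log}}-\frac{\{\{v_x^2\}\}+\{\{v_y^2\}\}}{2}\right)f^y_\rho+\{\{v_x\}\}f^y_{\rho v_x}+\{\{v_y\}\}f^y_{\rho v_y}.$$ These fluxes are entropy conservative, kinetic energy preserving, and consistent.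
   Context: Euler equations: $\partial_tu+\partial_xf_x(u)+\partial_yf_y(u)=0$, $u=(\rho,\rho v_x,\rho v_y,\rho e)^T$, $f_x=(\rho v_x,\rho v_x^2+p,\rho v_xv_y,(\rho e+p)v_x)^T$, $f_y=(\rho v_y,\rho v_xv_y,\rho v_y^2+p,(\rho e+p)v_y)^T$, $p=(\gamma-1)(\rho e-\frac12\rho v^2)$, $v^2=v_x^2+v_y^2$, $\gamma>1$ constant, $\rho,p>0$. With $s=\log(p/\rho^\gamma)$, the entropy is $U=-\rho s/(\gamma-1)$, the entropy variables are $w=\left(\frac{\gamma}{\gamma-1}-\frac{s}{\gamma-1}-\frac{\rho v^2}{2p},\frac{\rho v_x}{p},\frac{\rho v_y}{p},-\frac{\rho}{p}\right)^T$ and the flux potentials are $\psi_x=\rho v_x$, $\psi_y=\rho v_y$. Means of a quantity $a$ with values $a_-,a_+$ at the states $u_-,u_+$: $\{\{a\}\}=\frac{a_-+a_+}2$; for $a_\pm>0$, $\{\{a\}\}_{\log}=\frac{a_+-a_-}{\log a_+-\log a_-}$ (and $=a$ if $a_-=a_+=a$). The expression $\{\{\chi\}\}_{x\mapsto x^r}^{r-1}$ denotes $\frac1r\frac{\chi_+^r-\chi_-^r}{\chi_+-\chi_-}$ (and $\chi^{r-1}$ if $\chi_-=\chi_+=\chi$). A two-point flux $f^j=(f^j_\rho,f^j_{\rho v_x},f^j_{\rho v_y},f^j_{\rho e})^T(u_-,u_+)$, $j\in\{x,y\}$, is consistent if $f^j(u,u)=f_j(u)$; entropy conservative if $(w_+-w_-)\cdot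 f^j(u_-,u_+)-(\psi_{j,+}-\psi_{j,-})=0$ for all pairs of states; kinetic energy preserving if $f^j_{\rho v_j}=\{\{v_j\}\}f^j_\rho+p^{\mathrm{num}}$ with $p^{\mathrm{num}}$ a consistent approximation of the pressure, i.e. $p^{\mathrm{num}}(u,u)=p$ (here $p^{\mathrm{num}}=\{\{\rho\}\}/\{\{\rho/p\}\}$). *)

theory Defs
  imports "HOL-Analysis.Analysis"
begin

text \<open>
  States are vectors of conserved variables \<open>u = (\<rho>, \<rho> v\<^sub>x, \<rho> v\<^sub>y, \<rho> e)\<close>; velocity and pressure are
  derived from them. The divisions by \<open>\<rho>\<close> and \<open>p\<close> are meaningful on \<open>admissible \<gamma>\<close>.
\<close>

type_synonym state = "real ^ 4"

datatype axis = X_axis | Y_axis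

lemma vector_4 [simp]:
  "(vector [a, b, c, d] :: 'a::zero ^ 4) $ 1 = a"
  "(vector [a, b, c, d] :: 'a ^ 4) $ 2 = b"
  "(vector [a, b, c, d] :: 'a ^ 4) $ 3 = c"
  "(vector [a, b, c, d] :: 'a ^ 4) $ 4 = d"
  by (simp_all add: vector_def)

definition density :: "state \<Rightarrow> real" where
  "density u = u $ 1"

fun momentum_index :: "axis \<Rightarrow> 4" where
  "momentum_index X_axis = 2"
| "momentum_index Y_axis = 3"

definition velocity :: "axis \<Rightarrow> state \<Rightarrow> real" where
  "velocity j u = u $ momentum_index j / u $ 1"

abbreviation vx :: "state \<Rightarrow> real" where "vx \<equiv> velocity X_axis"
abbreviation vy :: "state \<Rightarrow> real" where "vy \<equiv> velocity Y_axis"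

definition speed_sq :: "state \<Rightarrow> real" where
  "speed_sq u = (vx u)\<^sup>2 + (vy u)\<^sup>2"

definition pressure :: "real \<Rightarrow> state \<Rightarrow> real" where
  "pressure \<gamma> u = (\<gamma> - 1) * (u $ 4 - 1/2 * density u * speed_sq u)"

definition admissible :: "real \<Rightarrow> state set" where
  "admissible \<gamma> = {u. density u > 0 \<and> pressure \<gamma> u > 0}"

fun phys_flux :: "real \<Rightarrow> axis \<Rightarrow> state \<Rightarrow> state" where
  "phys_flux \<gamma> X_axis u =
     vector [density u * vx u,
             density u * (vx u)\<^sup>2 + pressure \<gamma> u,
             density u * vx u * vy u,
             (u $ 4 + pressure \<gamma> u) * vx u]"
| "phys_flux \<gamma> Y_axis u =
     vector [density u * vy u,
             density u * vx u * vy u,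
             density u * (vy u)\<^sup>2 + pressure \<gamma> u,
             (u $ 4 + pressure \<gamma> u) * vy u]"

definition spec_entropy :: "real \<Rightarrow> state \<Rightarrow> real" where
  "spec_entropy \<gamma> u = ln (pressure \<gamma> u / density u powr \<gamma>)"

text \<open>The gradient of the entropy \<open>U = - \<rho> s / (\<gamma> - 1)\<close> with respect to the conserved variables.\<close>

definition entropy_vars :: "real \<Rightarrow> state \<Rightarrow> real ^ 4" where
  "entropy_vars \<gamma> u =
     vector [\<gamma> / (\<gamma> - 1) - spec_entropy \<gamma> u / (\<gamma> - 1)
               - density u * speed_sq u / (2 * pressure \<gamma> u),
             density u * vx u / pressure \<gamma> u,
             density u * vy u / pressure \<gamma> u,
             - density u / pressure \<gamma> u]"

definition flux_potential :: "axis \<Rightarrow> state \<Rightarrow> real" where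
  "flux_potential j u = density u * velocity j u"

definition arith_mean :: "real \<Rightarrow> real \<Rightarrow> real" where
  "arith_mean a b = (a + b) / 2"

definition log_mean :: "real \<Rightarrow> real \<Rightarrow> real" where
  "log_mean a b = (if a = b then a else (b - a) / (ln b - ln a))"

text \<open>\<open>power_mean r a b\<close> is the expression \<open>{{\<chi>}}\<^bsub>x \<mapsto> x^r\<^esub>\<^bsup>r-1\<^esup>\<close>, i.e. the \<open>(r-1)\<close>-th power
  of the generalised mean, and not that mean itself.\<close>

definition power_mean :: "real \<Rightarrow> real \<Rightarrow> real \<Rightarrow> real" where
  "power_mean r a b =
     (if a = b then a powr (r - 1) else 1 / r * ((b powr r - a powr r) / (b - a)))"

abbreviation avg :: "(state \<Rightarrow> real) \<Rightarrow> state \<Rightarrow> state \<Rightarrow> real" where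
  "avg q um up \<equiv> arith_mean (q um) (q up)"

type_synonym two_point_flux = "state \<Rightarrow> state \<Rightarrow> state"

definition consistent :: "real \<Rightarrow> axis \<Rightarrow> two_point_flux \<Rightarrow> bool" where
  "consistent \<gamma> j f \<longleftrightarrow> (\<forall>u \<in> admissible \<gamma>. f u u = phys_flux \<gamma> j u)"

definition entropy_conservative :: "real \<Rightarrow> axis \<Rightarrow> two_point_flux \<Rightarrow> bool" where
  "entropy_conservative \<gamma> j f \<longleftrightarrow>
     (\<forall>um \<in> admissible \<gamma>. \<forall>up \<in> admissible \<gamma>.
        (entropy_vars \<gamma> up - entropy_vars \<gamma> um) \<bullet> f um up
          - (flux_potential j up - flux_potential j um) = 0)"

text \<open>The numerical pressure is an argument: if it were existentially quantified, the first conjunct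
  could serve as its definition, and every consistent flux would qualify.\<close>

definition kinetic_energy_preserving ::
  "real \<Rightarrow> axis \<Rightarrow> (state \<Rightarrow> state \<Rightarrow> real) \<Rightarrow> two_point_flux \<Rightarrow> bool" where
  "kinetic_energy_preserving \<gamma> j pnum f \<longleftrightarrow>
     (\<forall>um \<in> admissible \<gamma>. \<forall>up \<in> admissible \<gamma>.
        f um up $ momentum_index j = avg (velocity j) um up * f um up $ 1 + pnum um up) \<and>
     (\<forall>u \<in> admissible \<gamma>. pnum u u = pressure \<gamma> u)"

definition num_pressure :: "real \<Rightarrow> state \<Rightarrow> state \<Rightarrow> real" where
  "num_pressure \<gamma> um up =
     avg density um up / avg (\<lambda>u. density u / pressure \<gamma> u) um up"

text \<open>The argument \<open>ch\<close> is the variable \<open>\<chi>\<close> with \<open>\<rho> / p = \<chi>\<^sup>r\<close>; the symbol \<open>\<chi>\<close> itself is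
  a binder of the vector library.\<close>

definition energy_coeff ::
  "real \<Rightarrow> real \<Rightarrow> (state \<Rightarrow> real) \<Rightarrow> state \<Rightarrow> state \<Rightarrow> real" where
  "energy_coeff \<gamma> r ch um up =
     1 / (\<gamma> - 1) * (1 / (power_mean r (ch um) (ch up) * log_mean (ch um) (ch up)))
       - (avg (\<lambda>u. (vx u)\<^sup>2) um up + avg (\<lambda>u. (vy u)\<^sup>2) um up) / 2"

fun num_flux :: "real \<Rightarrow> real \<Rightarrow> (state \<Rightarrow> real) \<Rightarrow> axis \<Rightarrow> two_point_flux" where
  "num_flux \<gamma> r ch X_axis um up =
     (let f\<rho> = log_mean (density um) (density up) * avg vx um up;
          fx = avg vx um up * f\<rho> + avg density um up / avg (\<lambda>u. density u / pressure \<gamma> u) um up;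
          fy = avg vy um up * f\<rho>;
          fe = energy_coeff \<gamma> r ch um up * f\<rho> + avg vx um up * fx + avg vy um up * fy
      in vector [f\<rho>, fx, fy, fe])"
| "num_flux \<gamma> r ch Y_axis um up =
     (let f\<rho> = log_mean (density um) (density up) * avg vy um up;
          fx = avg vx um up * f\<rho>;
          fy = avg vy um up * f\<rho> + avg density um up / avg (\<lambda>u. density u / pressure \<gamma> u) um up;
          fe = energy_coeff \<gamma> r ch um up * f\<rho> + avg vx um up * fx + avg vy um up * fy
      in vector [f\<rho>, fx, fy, fe])"

end

(* Write q = rho/p.  Up to constants, the first entropy variable is
   ln q / (gamma - 1) + ln rho - q v^2 / 2, and the others are q v_x, q v_y and -q.  The two
   logarithmic jumps are handled by exact chain rules: the logarithmic mean of rho turns the jump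
   of ln rho into that of rho, and the product of the two means of chi turns the jump of ln q into
   that of q = chi^r.  What remains is a polynomial identity expressing the discrete product rule
   [ab] = {a}[b] + {b}[a]. *)

theory Submission
  imports Defs
begin

text \<open>The product form also covers a = b, where both sides vanish, so equal states need no
  separate case later.\<close>

lemma log_mean_jump:
  assumes "a > 0" "b > 0"
  shows "log_mean a b * (ln b - ln a) = b - a"
  using assms by (simp add: log_mean_def)

lemma power_mean_jump:
  assumes "r \<noteq> 0"
  shows "r * power_mean r a b * (b - a) = b powr r - a powr r"
  using assms by (simp add: power_mean_def)

lemma log_mean_nonzero:
  assumes "a > 0" "b > 0"
  shows "log_mean a b \<noteq> 0"
  using assms by (simp add: log_mean_def)

lemma power_mean_nonzero:
  assumes "r \<noteq> 0" "a > 0" "b > 0"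
  shows "power_mean r a b \<noteq> 0"
proof (cases "a = b")
  case True
  then show ?thesis using assms by (simp add: power_mean_def)
next
  case False
  then have "ln a \<noteq> ln b" using assms by simp
  \<comment> \<open>Taking logarithms turns the powers into r ln a and r ln b, which differ because
    r is nonzero.\<close>
  then have "ln (a powr r) \<noteq> ln (b powr r)" using assms by (simp add: ln_powr)
  then have "a powr r \<noteq> b powr r" by metis
  with False show ?thesis using assms by (simp add: power_mean_def)
qed

text \<open>The power mean reduces the jump of chi^r to r times that of chi, and the logarithmic
  mean reduces the latter to the jump of ln chi. Both means are nonzero, so their product can be
  divided out.\<close>

lemma ln_powr_jump:
  assumes "r \<noteq> 0" "a > 0" "b > 0"
  shows "(b powr r - a powr r) * (1 / (power_mean r a b * log_mean a b))
           = ln (b powr r) - ln (a powr r)"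
proof -
  have "b powr r - a powr r = (power_mean r a b * log_mean a b) * (r * (ln b - ln a))"
    unfolding power_mean_jump[OF assms(1), symmetric] log_mean_jump[OF assms(2,3), symmetric]
    by (simp only: ac_simps)
  moreover have "ln (b powr r) - ln (a powr r) = r * (ln b - ln a)"
    using assms by (simp add: ln_powr right_diff_distrib)
  ultimately show ?thesis
    using power_mean_nonzero[OF assms] log_mean_nonzero[OF assms(2,3)]
    by simp
qed

text \<open>Grouping ln p - \<gamma> ln \<rho> this way gives ln \<rho> the coefficient 1 in the
  first entropy variable once s is divided by 1 - \<gamma>.\<close>

lemma spec_entropy_eq:
  assumes "u \<in> admissible \<gamma>"
  shows "spec_entropy \<gamma> u = - ln (density u / pressure \<gamma> u) - (\<gamma> - 1) * ln (density u)"
  using assms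
  by (simp add: admissible_def spec_entropy_def ln_div ln_powr algebra_simps)

lemma entropy_vars_eq:
  assumes "\<gamma> > 1" "u \<in> admissible \<gamma>"
  defines "q \<equiv> density u / pressure \<gamma> u"
  shows "entropy_vars \<gamma> u =
    vector [\<gamma> / (\<gamma> - 1) + ln q / (\<gamma> - 1) + ln (density u) - q * ((vx u)\<^sup>2 + (vy u)\<^sup>2) / 2,
            q * vx u, q * vy u, - q]"
proof -
  have "(- l - g * m) / g = - (l / g) - m" if "g \<noteq> 0" for g l m :: real
    using that by (simp add: divide_simps)
  then have "(- l - (\<gamma> - 1) * m) / (\<gamma> - 1) = - (l / (\<gamma> - 1)) - m" for l m
    using \<open>\<gamma> > 1\<close> by simp
  then show ?thesis
    unfolding entropy_vars_def spec_entropy_eq[OF assms(2)] q_def speed_sq_def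
    by (simp add: mult.commute[of _ 2] diff_diff_eq2 add_ac)
qed

text \<open>The weights \<open>\<alpha>\<close>, \<open>\<beta>\<close> select the flux direction: \<open>(1, 0)\<close> for \<open>x\<close> and \<open>(0, 1)\<close> for \<open>y\<close>. The mass
  flux is \<open>F\<close>, the values of \<open>ln q\<close> and \<open>ln \<rho>\<close> are \<open>l\<close> and \<open>s\<close>, and \<open>g\<close> is \<open>\<gamma> - 1\<close>.\<close>

lemma entropy_conservation_identity:
  fixes qm qp \<rho>m \<rho>p mm mp nm np lm lp sm sp \<alpha> \<beta> B F c g :: real
  assumes L: "(qp - qm) * B = lp - lm"
    and S: "F * (sp - sm) = (\<rho>p - \<rho>m) * (\<alpha> * arith_mean mm mp + \<beta> * arith_mean nm np)"
    and q: "arith_mean qm qp \<noteq> 0"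
    and fx: "fx = arith_mean mm mp * F + \<alpha> * (arith_mean \<rho>m \<rho>p / arith_mean qm qp)"
    and fy: "fy = arith_mean nm np * F + \<beta> * (arith_mean \<rho>m \<rho>p / arith_mean qm qp)"
  shows "(c + lp / g + sp - qp * (mp\<^sup>2 + np\<^sup>2) / 2 - (c + lm / g + sm - qm * (mm\<^sup>2 + nm\<^sup>2) / 2)) * F
      + (qp * mp - qm * mm) * fx + (qp * np - qm * nm) * fy
      + (- qp - - qm) * ((1 / g * B - (arith_mean (mm\<^sup>2) (mp\<^sup>2) + arith_mean (nm\<^sup>2) (np\<^sup>2)) / 2) * F
          + arith_mean mm mp * fx + arith_mean nm np * fy)
      = \<alpha> * (\<rho>p * mp - \<rho>m * mm) + \<beta> * (\<rho>p * np - \<rho>m * nm)" (is "?l = ?r")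
proof -
  define P where "P = arith_mean \<rho>m \<rho>p / arith_mean qm qp"
  define \<kappa> where "\<kappa> = 1 / g"
  \<comment> \<open>This is where the choice of numerical pressure enters: its product with the mean
    of q is the mean of \<rho>.\<close>
  have P: "P * (qm + qp) = \<rho>m + \<rho>p"
    using q by (simp add: P_def arith_mean_def divide_simps) (simp add: algebra_simps)
  have div_g: "x / g = \<kappa> * x" for x by (simp add: \<kappa>_def)
  have lp: "lp = lm + (qp - qm) * B" using L by simp
  \<comment> \<open>The jump of ln q cancels against the \<open>B\<close> term of the energy flux.
    By the product rule the momentum and energy terms combine to {q}[v] times the momentum fluxes;
    their \<open>F\<close> part cancels the kinetic terms {q}[v^2]/2 and leaves the pressure
    part.\<close>
  have "?l = F * (sp - sm) + P * (qm + qp) * (\<alpha> * (mp - mm) + \<beta> * (np - nm)) / 2"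
    unfolding fx fy P_def[symmetric] unfolding div_g lp arith_mean_def
    by (simp add: field_simps power2_eq_square)
  \<comment> \<open>The two summands are now [\<rho>]{v} and {\<rho>}[v] along the axis, which add
    up to [\<rho> v].\<close>
  also have "\<dots> = ?r"
    unfolding P S by (simp add: arith_mean_def field_simps)
  finally show ?thesis .
qed

lemma inner_vector_4:
  "(vector [a, b, c, d] - vector [a', b', c', d'] :: real ^ 4) \<bullet> vector [e, f, g, h]
     = (a - a') * e + (b - b') * f + (c - c') * g + (d - d') * h"
  by (simp add: inner_vec_def sum_4)

lemma num_flux_entropy_conservative:
  assumes \<gamma>: "\<gamma> > 1" and r: "r \<noteq> 0"
    and ch: "\<And>u. u \<in> admissible \<gamma> \<Longrightarrow> ch u > 0 \<and> density u / pressure \<gamma> u = ch u powr r"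
  shows "entropy_conservative \<gamma> j (num_flux \<gamma> r ch j)"
  unfolding entropy_conservative_def
proof (intro ballI)
  fix um up assume um: "um \<in> admissible \<gamma>" and up: "up \<in> admissible \<gamma>"
  define qm where "qm = density um / pressure \<gamma> um"
  define qp where "qp = density up / pressure \<gamma> up"
  define B where "B = 1 / (power_mean r (ch um) (ch up) * log_mean (ch um) (ch up))"
  define lm where "lm = log_mean (density um) (density up)"
  have "qm > 0" "qp > 0" using um up by (auto simp: qm_def qp_def admissible_def)
  then have q: "arith_mean qm qp \<noteq> 0" by (simp add: arith_mean_def)
  have L: "(qp - qm) * B = ln qp - ln qm"
    using ch[OF um] ch[OF up] ln_powr_jump[OF r] by (simp add: B_def qm_def qp_def)
  have "lm * (ln (density up) - ln (density um)) = density up - density um"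
    using um up by (auto simp: lm_def admissible_def intro: log_mean_jump)
  \<comment> \<open>The free factor \<open>a\<close> stands for the mean of either velocity
    component, so both axes are served.\<close>
  then have S: "lm * a * (ln (density up) - ln (density um)) = (density up - density um) * a" for a
    by (metis mult.assoc mult.commute)
  show "(entropy_vars \<gamma> up - entropy_vars \<gamma> um) \<bullet> num_flux \<gamma> r ch j um up
          - (flux_potential j up - flux_potential j um) = 0"
  proof (cases j)
    case X_axis
    show ?thesis
      unfolding X_axis num_flux.simps Let_def entropy_vars_eq[OF \<gamma> um] entropy_vars_eq[OF \<gamma> up]
        inner_vector_4 energy_coeff_def flux_potential_def
        qm_def[symmetric] qp_def[symmetric] B_def[symmetric] lm_def[symmetric]
      by (subst entropy_conservation_identity[OF L _ q, where \<alpha> = 1 and \<beta> = 0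
            and \<rho>m = "density um" and \<rho>p = "density up"])
        (simp_all only: S, simp_all)
  next
    case Y_axis
    show ?thesis
      unfolding Y_axis num_flux.simps Let_def entropy_vars_eq[OF \<gamma> um] entropy_vars_eq[OF \<gamma> up]
        inner_vector_4 energy_coeff_def flux_potential_def
        qm_def[symmetric] qp_def[symmetric] B_def[symmetric] lm_def[symmetric]
      by (subst entropy_conservation_identity[OF L _ q, where \<alpha> = 0 and \<beta> = 1
            and \<rho>m = "density um" and \<rho>p = "density up"])
        (simp_all only: S, simp_all)
  qed
qed

lemma arith_mean_same [simp]: "arith_mean a a = a"
  by (simp add: arith_mean_def)

lemma log_mean_same [simp]: "log_mean a a = a"
  by (simp add: log_mean_def)

text \<open>The required momentum form is built into the flux; at equal states the numerical
  pressure is \<rho> / (\<rho> / p) = p.\<close>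

lemma num_flux_kinetic_energy_preserving:
  "kinetic_energy_preserving \<gamma> j (num_pressure \<gamma>) (num_flux \<gamma> r ch j)"
proof -
  have "num_flux \<gamma> r ch j um up $ momentum_index j
      = avg (velocity j) um up * num_flux \<gamma> r ch j um up $ 1 + num_pressure \<gamma> um up" for um up
    by (cases j) (simp_all add: num_pressure_def Let_def)
  moreover have "num_pressure \<gamma> u u = pressure \<gamma> u" if "u \<in> admissible \<gamma>" for u
    using that by (simp add: num_pressure_def admissible_def)
  ultimately show ?thesis
    unfolding kinetic_energy_preserving_def by blast
qed

lemma total_energy_eq:
  assumes "\<gamma> > 1"
  shows "u $ 4 = pressure \<gamma> u / (\<gamma> - 1) + density u * ((vx u)\<^sup>2 + (vy u)\<^sup>2) / 2"
  using assms by (simp add: pressure_def speed_sq_def)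

lemma num_flux_consistent:
  assumes \<gamma>: "\<gamma> > 1"
    and ch: "\<And>u. u \<in> admissible \<gamma> \<Longrightarrow> ch u > 0 \<and> density u / pressure \<gamma> u = ch u powr r"
  shows "consistent \<gamma> j (num_flux \<gamma> r ch j)"
  unfolding consistent_def
proof
  fix u assume u: "u \<in> admissible \<gamma>"
  have pos: "density u > 0" "pressure \<gamma> u > 0" using u by (auto simp: admissible_def)
  \<comment> \<open>On the diagonal the two means are chi^(r-1) and chi.\<close>
  have means: "power_mean r (ch u) (ch u) * log_mean (ch u) (ch u) = density u / pressure \<gamma> u"
    using ch[OF u] by (simp add: power_mean_def powr_diff)
  have "(1 / g * (1 / (density u / pressure \<gamma> u)) - k / 2) * density u
      = pressure \<gamma> u / g - density u * k / 2" if "g \<noteq> 0" for g k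
    using pos that by (simp add: field_simps)
  then have coeff: "energy_coeff \<gamma> r ch u u * density u
      = pressure \<gamma> u / (\<gamma> - 1) - density u * ((vx u)\<^sup>2 + (vy u)\<^sup>2) / 2"
    unfolding energy_coeff_def means arith_mean_same using \<gamma> by simp
  \<comment> \<open>The coefficient carries internal minus kinetic energy; the velocity-weighted
    momentum fluxes later add twice the kinetic energy and the pressure work.\<close>
  have energy: "energy_coeff \<gamma> r ch u u * density u
      = u $ 4 - density u * ((vx u)\<^sup>2 + (vy u)\<^sup>2)"
    unfolding coeff total_energy_eq[OF \<gamma>, of u] by (simp add: field_simps)
  have energy': "energy_coeff \<gamma> r ch u u * (density u * v)
      = (u $ 4 - density u * ((vx u)\<^sup>2 + (vy u)\<^sup>2)) * v" for v
    unfolding energy[symmetric] by simp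
  have mean_pressure: "density u / (density u / pressure \<gamma> u) = pressure \<gamma> u"
    using pos by simp
  show "num_flux \<gamma> r ch j u u = phys_flux \<gamma> j u"
  proof (cases j)
    case X_axis
    show ?thesis
      unfolding X_axis num_flux.simps phys_flux.simps Let_def
        arith_mean_same log_mean_same mean_pressure energy'
      by (simp add: vec_eq_iff forall_4) (simp add: algebra_simps power2_eq_square)
  next
    case Y_axis
    show ?thesis
      unfolding Y_axis num_flux.simps phys_flux.simps Let_def
        arith_mean_same log_mean_same mean_pressure energy'
      by (simp add: vec_eq_iff forall_4) (simp add: algebra_simps power2_eq_square)
  qed
qed

theorem mainTheorem8:
  fixes \<gamma> r :: real and ch :: "state \<Rightarrow> real"
  assumes "\<gamma> > 1"
    and "r \<noteq> 0"
    and "\<And>u. u \<in> admissible \<gamma> \<Longrightarrow> ch u > 0 \<and> density u / pressure \<gamma> u = ch u powr r"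
  shows "\<forall>j. entropy_conservative \<gamma> j (num_flux \<gamma> r ch j)
           \<and> kinetic_energy_preserving \<gamma> j (num_pressure \<gamma>) (num_flux \<gamma> r ch j)
           \<and> consistent \<gamma> j (num_flux \<gamma> r ch j)"
  using assms num_flux_entropy_conservative num_flux_kinetic_energy_preserving num_flux_consistent
  by blast

end
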